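(* Let $\{P_n:n\in\mathbb{N}_0\}$ be the Legendre polynomials, $\{T_n:n\in\mathbb{N}_0\}$ the Chebyshev polynomials of the first kind and $\{U_n:n\in\mathbb{N}_0\}$ the Chebyshev polynomials of the second kind. For $x,y\in(-1,1)$, $$\lim_{N\to\infty}N\sum_{n=N+1}^\infty\frac{(2n+1)P_n(x)P_n(y)}{2n(n+1)}=\begin{cases}\dfrac{1}{\pi\sqrt{1-x^2}}&\text{if }x=y,\\[0.5em]0&\text{if }x\neq y,\end{cases}$$ as well as $$\lim_{N\to\infty}N\sum_{n=N+1}^\infty\frac{T_n(x)T_n(y)}{n^2}=\begin{cases}\frac12&\text{if }x=y,\\0&\text{if }x\neq y,\end{cases}$$ and $$\lim_{N\to\infty}N\sum_{n=N+1}^\infty\frac{U_n(x)U_n(y)}{n(n+2)}=\begin{cases}\dfrac{1}{2(1-x^2)}&\text{if }x=y,\\[0.5em]0&\text{if }x\neq y.\end{cases}$$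
   Context: Standard normalisations are used: in terms of the Jacobi polynomials $P_n^{(\alpha,\beta)}$ (normalised by $P_n^{(\alpha,\beta)}(1)=\Gamma(n+\alpha+1)/(n!\,\Gamma(\alpha+1))$), $P_n=P_n^{(0,0)}$, $T_n=\frac{n!\sqrt{\pi}}{\Gamma(n+\frac12)}P_n^{(-\frac12,-\frac12)}$ and $U_n=\frac{(n+1)!\sqrt{\pi}}{2\,\Gamma(n+\frac32)}P_n^{(\frac12,\frac12)}$. *)

theory Defs
  imports "HOL-Analysis.Analysis" "HOL-Computational_Algebra.Polynomial"
begin

text \<open>
  The Jacobi polynomial of degree \<open>n\<close> is the terminating hypergeometric series
  \<open>((a+1)\<^sub>n / n!) \<cdot> \<^sub>2F\<^sub>1(-n, n+a+b+1; a+1; (1-x)/2)\<close>,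
  where \<open>(c)\<^sub>k\<close> is the rising factorial. The intended range is \<open>a, b > -1\<close>, so that
  no factor \<open>(a+1)\<^sub>k\<close> vanishes.
\<close>

definition jacobi_poly :: "real \<Rightarrow> real \<Rightarrow> nat \<Rightarrow> real poly" where
  "jacobi_poly a b n =
     smult (pochhammer (a + 1) n / fact n)
       (\<Sum>k\<le>n. smult (pochhammer (- real n) k * pochhammer (real n + a + b + 1) k /
                        (pochhammer (a + 1) k * fact k))
                  ([:1/2, -1/2:] ^ k))"

lemma poly_jacobi_poly_1:
  assumes "a > -1"
  shows "poly (jacobi_poly a b n) 1 = Gamma (real n + a + 1) / (fact n * Gamma (a + 1))"
proof -
  have "poly (jacobi_poly a b n) 1 = pochhammer (a + 1) n / fact n"
    by (simp add: jacobi_poly_def poly_sum power_0_left if_distrib cong: if_cong)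
  moreover have "a + 1 \<notin> \<int>\<^sub>\<le>\<^sub>0"
    using assms by (auto elim!: nonpos_Ints_cases)
  ultimately show ?thesis
    by (simp add: pochhammer_Gamma add_ac)
qed

definition legendre_poly :: "nat \<Rightarrow> real poly" where
  "legendre_poly n = jacobi_poly 0 0 n"

definition chebyshev_T :: "nat \<Rightarrow> real poly" where
  "chebyshev_T n =
     smult (fact n * sqrt pi / Gamma (real n + 1/2)) (jacobi_poly (-1/2) (-1/2) n)"

definition chebyshev_U :: "nat \<Rightarrow> real poly" where
  "chebyshev_U n =
     smult (fact (n + 1) * sqrt pi / (2 * Gamma (real n + 3/2))) (jacobi_poly (1/2) (1/2) n)"

end

theory Submission
  imports Defs "HOL-Real_Asymp.Real_Asymp"
begin

text \<open>
  If the partial sums of \<open>a\<^sub>n - L\<close> are bounded, then \<open>N\<close> times the tail of \<open>\<Sum>a\<^sub>n / n\<^sup>2\<close> beyond \<open>N\<close> tends to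
  \<open>L\<close>, the mean value of \<open>a\<^sub>n\<close>, and an error \<open>o(1 / n\<^sup>2)\<close> in the terms does not change
  this limit (\<open>tail_of_bounded_oscillation\<close>). Each of the three limits is the mean value of a product
  of two oscillations.

  Put \<open>x = cos \<theta>\<close> and \<open>y = cos \<phi>\<close> with \<open>0 < \<theta>, \<phi> < \<pi>\<close>. In all three cases \<open>n\<^sup>2\<close> times the \<open>n\<close>-th term
  is, up to a null sequence,
  \<open>A \<cdot> cos (n \<theta> + \<beta> \<theta>) \<cdot> cos (n \<phi> + \<beta> \<phi>)\<close> with an amplitude \<open>A\<close> independent of \<open>n\<close> and a phase
  shift \<open>\<beta>\<close> that depends only on the angle. By the product formula this is a sum of cosines with
  frequencies \<open>\<theta> - \<phi>\<close> and \<open>\<theta> + \<phi>\<close>; the partial sums of a cosine whose frequency is not a multiple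
  of \<open>2 \<pi>\<close> are bounded, so such a cosine has mean \<open>0\<close>. Only the frequency \<open>0\<close>, present
  exactly if \<open>\<theta> = \<phi>\<close>, survives, and it contributes \<open>A / 2\<close>. This part is \<open>tail_of_cos_product\<close>.

  The oscillation comes from the Jacobi differential equation. If \<open>P\<close> is the Jacobi polynomial of degree \<open>n\<close>
  with both parameters equal to \<open>a\<close>, then \<open>(sin t)\<close> to the power \<open>a + 1/2\<close>, times \<open>P (cos t)\<close>, solves
  \<open>u'' = - ((n + a + 1/2)\<^sup>2 + (1/4 - a\<^sup>2) / (sin t)\<^sup>2) u\<close>. For \<open>a = \<plusminus> 1/2\<close> this is a harmonic
  oscillator, whence \<open>T\<^sub>n (cos t) = cos (n t)\<close> and \<open>U\<^sub>n (cos t) = sin ((n + 1) t) / sin t\<close>. For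
  \<open>a = 0\<close> it is a perturbation of one that becomes negligible, relative to the frequency, on compact
  subintervals of \<open>(0, \<pi>)\<close>. Starting from the midpoint \<open>t = \<pi> / 2\<close>, where \<open>P\<^sub>n 0\<close> and
  \<open>P\<^sub>n' 0\<close> are known from the three-term recurrence and their size from Wallis' argument,
  \<open>perturbed_oscillator_self_bounded\<close> yields the formula of Laplace (\<open>legendre_asymptotics\<close>)
  \<open>sqrt (sin \<theta>) P\<^sub>n (cos \<theta>) \<approx> sqrt (2 / (\<pi> n)) cos ((n + 1/2) \<theta> - \<pi> / 4)\<close>.
\<close>

section \<open>Oscillator equations with a small perturbation\<close>

text \<open>
  Variation of constants in differential form. For fixed \<open>\<theta>\<close>, evolve the data \<open>(u t, u' t)\<close> from time
  \<open>t\<close> to time \<open>\<theta>\<close> by the unperturbed equation \<open>v'' = - \<nu>\<^sup>2 v\<close>, and let \<open>A t\<close> be the value reached. Then \<open>A \<theta> = u \<theta>\<close>,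
  whereas \<open>A s\<close> is the unperturbed solution with the data at \<open>s\<close>, and the derivative of \<open>A\<close>
  contains only the perturbation, divided by \<open>\<nu>\<close>.
\<close>

lemma perturbed_oscillator:
  fixes u u' q :: "real \<Rightarrow> real"
  assumes \<nu>: "\<nu> > 0"
    and du: "\<And>t. t \<in> {l..r} \<Longrightarrow> (u has_real_derivative u' t) (at t)"
    and du': "\<And>t. t \<in> {l..r} \<Longrightarrow> (u' has_real_derivative - (\<nu>\<^sup>2 + q t) * u t) (at t)"
    and q: "\<And>t. t \<in> {l..r} \<Longrightarrow> \<bar>q t\<bar> \<le> K"
    and M: "\<And>t. t \<in> {l..r} \<Longrightarrow> \<bar>u t\<bar> \<le> M"
    and s: "s \<in> {l..r}" and \<theta>: "\<theta> \<in> {l..r}"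
  shows "\<bar>u \<theta> - (u s * cos (\<nu> * (\<theta> - s)) + u' s / \<nu> * sin (\<nu> * (\<theta> - s)))\<bar> \<le> K * M / \<nu> * \<bar>\<theta> - s\<bar>"
proof -
  define A where "A t = u t * cos (\<nu> * (\<theta> - t)) + u' t / \<nu> * sin (\<nu> * (\<theta> - t))" for t
  have A': "(A has_real_derivative - (q t * u t * sin (\<nu> * (\<theta> - t)) / \<nu>)) (at t within {l..r})"
    if "t \<in> {l..r}" for t
    unfolding A_def
    by (rule derivative_eq_intros has_field_derivative_at_within[OF du[OF that]] 
      has_field_derivative_at_within[OF du'[OF that]] refl | use \<nu> in \<open>simp add: field_simps power2_eq_square\<close>)+
  have "norm (A \<theta> - A s) \<le> K * M / \<nu> * norm (\<theta> - s)"
  proof (rule field_differentiable_bound[OF _ A'])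
    show "norm (- (q t * u t * sin (\<nu> * (\<theta> - t)) / \<nu>)) \<le> K * M / \<nu>" if t: "t \<in> {l..r}" for t
    proof -
      have "\<bar>q t * u t * sin (\<nu> * (\<theta> - t))\<bar> \<le> K * M * 1"
        unfolding abs_mult using q[OF t] M[OF t] by (intro mult_mono) (auto intro: order.trans[OF abs_ge_zero])
      then show ?thesis using \<nu> by (simp add: divide_right_mono abs_divide)
    qed
  qed (use s \<theta> in auto)
  then show ?thesis by (simp add: A_def)
qed

text \<open>
  The bound \<open>M\<close> on the solution needed for \<open>perturbed_oscillator\<close> comes for free at high frequency: at a point
  \<open>p\<close> where \<open>\<bar>u\<bar>\<close> is maximal, the deviation from the unperturbed solution is at most half of \<open>\<bar>u p\<bar>\<close>,
  so \<open>\<bar>u p\<bar>\<close> is at most twice the amplitude of the unperturbed solution.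
\<close>

lemma perturbed_oscillator_self_bounded:
  fixes u u' q :: "real \<Rightarrow> real"
  assumes \<nu>: "\<nu> > 0" and small: "2 * K * (r - l) \<le> \<nu>"
    and du: "\<And>t. t \<in> {l..r} \<Longrightarrow> (u has_real_derivative u' t) (at t)"
    and du': "\<And>t. t \<in> {l..r} \<Longrightarrow> (u' has_real_derivative - (\<nu>\<^sup>2 + q t) * u t) (at t)"
    and q: "\<And>t. t \<in> {l..r} \<Longrightarrow> \<bar>q t\<bar> \<le> K"
    and s: "s \<in> {l..r}" and \<theta>: "\<theta> \<in> {l..r}"
  shows "\<bar>u \<theta> - (u s * cos (\<nu> * (\<theta> - s)) + u' s / \<nu> * sin (\<nu> * (\<theta> - s)))\<bar>
    \<le> 2 * K * (r - l) / \<nu> * (\<bar>u s\<bar> + \<bar>u' s\<bar> / \<nu>)"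
proof -
  define main where "main t = u s * cos (\<nu> * (t - s)) + u' s / \<nu> * sin (\<nu> * (t - s))" for t
  define m where "m = \<bar>u s\<bar> + \<bar>u' s\<bar> / \<nu>"
  have K: "K \<ge> 0" using q[OF s] by linarith
  have "continuous_on {l..r} u"
    by (rule DERIV_continuous_on[OF has_field_derivative_at_within[OF du]])
  then have "continuous_on {l..r} (\<lambda>t. \<bar>u t\<bar>)"
    by (rule continuous_on_rabs)
  then obtain p where p: "p \<in> {l..r}" and max: "\<And>t. t \<in> {l..r} \<Longrightarrow> \<bar>u t\<bar> \<le> \<bar>u p\<bar>"
    using continuous_attains_sup[of "{l..r}" "\<lambda>t. \<bar>u t\<bar>"] s by auto
  have dev: "\<bar>u t - main t\<bar> \<le> K * (r - l) / \<nu> * \<bar>u p\<bar>" if t: "t \<in> {l..r}" for t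
  proof -
    have "\<bar>u t - main t\<bar> \<le> K * \<bar>u p\<bar> / \<nu> * \<bar>t - s\<bar>"
      unfolding main_def by (rule perturbed_oscillator[OF \<nu> du du' q max s t])
    also have "\<dots> \<le> K * \<bar>u p\<bar> / \<nu> * (r - l)"
      using t s K \<nu> by (intro mult_left_mono) auto
    finally show ?thesis by (simp add: mult_ac)
  qed
  have "\<bar>main p\<bar> \<le> \<bar>u s * cos (\<nu> * (p - s))\<bar> + \<bar>u' s / \<nu> * sin (\<nu> * (p - s))\<bar>"
    unfolding main_def by (rule abs_triangle_ineq)
  also have "\<dots> \<le> \<bar>u s\<bar> * 1 + \<bar>u' s / \<nu>\<bar> * 1"
    unfolding abs_mult by (intro add_mono mult_left_mono abs_cos_le_one abs_sin_le_one abs_ge_zero)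
  finally have "\<bar>main p\<bar> \<le> m" using \<nu> by (simp add: m_def)
  moreover have "K * (r - l) / \<nu> * \<bar>u p\<bar> \<le> 1 / 2 * \<bar>u p\<bar>"
    using small \<nu> by (intro mult_right_mono) (auto simp: field_simps)
  ultimately have "\<bar>u p\<bar> \<le> 2 * m" using dev[OF p] by linarith
  then have "K * (r - l) / \<nu> * \<bar>u p\<bar> \<le> K * (r - l) / \<nu> * (2 * m)"
    using K s \<nu> by (intro mult_left_mono) auto
  also have "\<dots> = 2 * K * (r - l) / \<nu> * m" by simp
  finally show ?thesis using dev[OF \<theta>] unfolding main_def m_def by linarith
qed

lemma harmonic_oscillator:
  fixes u u' :: "real \<Rightarrow> real"
  assumes "\<nu> > 0"
    and "\<And>t. (u has_real_derivative u' t) (at t)"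
    and "\<And>t. (u' has_real_derivative - \<nu>\<^sup>2 * u t) (at t)"
  shows "u \<theta> = u 0 * cos (\<nu> * \<theta>) + u' 0 / \<nu> * sin (\<nu> * \<theta>)"
proof -
  have "\<theta> \<in> {- \<bar>\<theta>\<bar>..\<bar>\<theta>\<bar>}" by auto
  then show ?thesis
    using perturbed_oscillator_self_bounded[of \<nu> 0 "\<bar>\<theta>\<bar>" "- \<bar>\<theta>\<bar>" u u' "\<lambda>_. 0" 0 \<theta>] assms
    by simp
qed

section \<open>The Jacobi differential equation\<close>

text \<open>
  The coefficients of the hypergeometric series in \<open>(1 - x) / 2\<close>. Its polynomial in that variable is studied
  first, because the differential equation is then a first order recurrence for the coefficients.
\<close>

definition jacobi_coeff :: "real \<Rightarrow> real \<Rightarrow> nat \<Rightarrow> nat \<Rightarrow> real" where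
  "jacobi_coeff a b n k = pochhammer (- real n) k * pochhammer (real n + a + b + 1) k /
                        (pochhammer (a + 1) k * fact k)"

definition jacobi_series :: "real \<Rightarrow> real \<Rightarrow> nat \<Rightarrow> real poly" where
  "jacobi_series a b n = (\<Sum>k\<le>n. monom (jacobi_coeff a b n k) k)"

text \<open>
  The factor \<open>pochhammer (- n) k\<close> terminates the series, so that identities can be compared coefficient by
  coefficient without regard to the degree.
\<close>

lemma jacobi_coeff_eq_0: "k > n \<Longrightarrow> jacobi_coeff a b n k = 0"
  by (simp add: jacobi_coeff_def pochhammer_of_nat_eq_0_iff)

lemma coeff_jacobi_series: "coeff (jacobi_series a b n) k = jacobi_coeff a b n k"
  by (simp add: jacobi_series_def coeff_sum jacobi_coeff_eq_0 if_distrib cong: if_cong)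

lemma jacobi_poly_eq_pcompose:
  "jacobi_poly a b n = smult (pochhammer (a + 1) n / fact n) (pcompose (jacobi_series a b n) [:1/2, -1/2:])"
proof -
  have "pcompose (p ^ k) q = pcompose p q ^ k" for p q :: "real poly" and k
    by (induction k) (simp_all add: pcompose_mult pcompose_1)
  then have "pcompose (monom c k) p = smult c (p ^ k)" for c :: real and k p
    by (simp add: monom_altdef pcompose_smult pcompose_pCons)
  then show ?thesis
    by (simp add: jacobi_poly_def jacobi_series_def pcompose_sum jacobi_coeff_def)
qed

lemma jacobi_coeff_Suc:
  assumes "a > -1"
  shows "(real k + 1) * (real k + a + 1) * jacobi_coeff a b n (Suc k)
      = (real k - real n) * (real k + real n + a + b + 1) * jacobi_coeff a b n k"
proof -
  have "pochhammer (a + 1) k > 0" "a + 1 + real k > 0"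
    using assms by (auto intro: pochhammer_pos)
  then show ?thesis
    by (simp add: jacobi_coeff_def pochhammer_Suc divide_simps) (simp add: algebra_simps)
qed

text \<open>
  At \<open>t\<^sup>k\<close> the equation says exactly \<open>jacobi_coeff_Suc\<close>.
\<close>

lemma hypergeometric_equation:
  assumes "a > -1"
  shows "[:0, 1, -1:] * pderiv (pderiv (jacobi_series a b n)) + [:a + 1, - (a + b + 2):] * pderiv (jacobi_series a b n)
    + smult (real n * (real n + a + b + 1)) (jacobi_series a b n) = 0" (is "?p = 0")
proof (rule poly_eqI)
  fix k
  have "coeff ?p k = (real k + 1) * (real k + a + 1) * jacobi_coeff a b n (Suc k)
      - (real k - real n) * (real k + real n + a + b + 1) * jacobi_coeff a b n k"
  proof (cases k)
    case 0
    then show ?thesis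
      by (simp add: coeff_pderiv coeff_jacobi_series algebra_simps)
  next
    case (Suc j)
    then show ?thesis
      by (cases j) (simp_all add: coeff_pderiv coeff_jacobi_series, simp_all add: algebra_simps)
  qed
  then show "coeff ?p k = coeff 0 k" using jacobi_coeff_Suc[OF assms] by simp
qed

text \<open>
  The hypergeometric equation under the substitution \<open>t = (1 - x) / 2\<close>, for which \<open>1 - x\<^sup>2 = 4 t (1 - t)\<close>.
\<close>

lemma jacobi_equation:
  fixes a b x :: real and n :: nat
  assumes "a > -1"
  defines "P \<equiv> jacobi_poly a b n"
  shows "(1 - x\<^sup>2) * poly (pderiv (pderiv P)) x + (b - a - (a + b + 2) * x) * poly (pderiv P) x
    + real n * (real n + a + b + 1) * poly P x = 0"
proof -
  define F where "F = jacobi_series a b n"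
  define A where "A = pochhammer (a + 1) n / fact n"
  define t where "t = (1 - x) / 2"
  have P: "P = smult A (pcompose F [:1/2, -1/2:])"
    by (simp add: P_def F_def A_def jacobi_poly_eq_pcompose)
  have x: "x = 1 - 2 * t" by (simp add: t_def field_simps)
  have t: "poly [:1/2, -1/2:] x = t" by (simp add: t_def diff_divide_distrib)
  have v: "poly P x = A * poly F t" "poly (pderiv P) x = - A / 2 * poly (pderiv F) t"
     "poly (pderiv (pderiv P)) x = A / 4 * poly (pderiv (pderiv F)) t"
    by (simp_all add: P pderiv_smult pderiv_pcompose poly_pcompose pderiv_mult pderiv_pCons pderiv_minus t[simplified])
  have "poly ([:0, 1, -1:] * pderiv (pderiv F) + [:a + 1, - (a + b + 2):] * pderiv F
    + smult (real n * (real n + a + b + 1)) F) t = 0"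
    unfolding F_def hypergeometric_equation[OF assms(1)] by simp
  then have "A * (t * (1 - t) * poly (pderiv (pderiv F)) t + (a + 1 - (a + b + 2) * t) * poly (pderiv F) t
    + real n * (real n + a + b + 1) * poly F t) = 0"
    by (simp add: algebra_simps)
  then show ?thesis unfolding v unfolding x by (simp add: field_simps power2_eq_square)
qed

section \<open>Chebyshev polynomials as trigonometric functions\<close>

lemma chebyshev_T_equation:
  fixes n :: nat and x :: real
  defines "P \<equiv> chebyshev_T n"
  shows "(1 - x\<^sup>2) * poly (pderiv (pderiv P)) x - x * poly (pderiv P) x + (real n)\<^sup>2 * poly P x = 0"
proof -
  define c where "c = fact n * sqrt pi / Gamma (real n + 1/2)"
  define J where "J = jacobi_poly (-1/2) (-1/2) n"
  have P: "P = smult c J" by (simp add: P_def chebyshev_T_def c_def J_def)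
  have "(1 - x\<^sup>2) * poly (pderiv (pderiv J)) x - x * poly (pderiv J) x + (real n)\<^sup>2 * poly J x = 0"
    using jacobi_equation[of "-1/2" x "-1/2" n] by (simp add: J_def power2_eq_square algebra_simps)
  then have "c * ((1 - x\<^sup>2) * poly (pderiv (pderiv J)) x - x * poly (pderiv J) x + (real n)\<^sup>2 * poly J x) = 0"
    by simp
  then show ?thesis by (simp add: P pderiv_smult algebra_simps)
qed

lemma chebyshev_U_equation:
  fixes n :: nat and x :: real
  defines "P \<equiv> chebyshev_U n"
  shows "(1 - x\<^sup>2) * poly (pderiv (pderiv P)) x - 3 * x * poly (pderiv P) x + real n * (real n + 2) * poly P x = 0"
proof -
  define c where "c = fact (n + 1) * sqrt pi / (2 * Gamma (real n + 3/2))"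
  define J where "J = jacobi_poly (1/2) (1/2) n"
  have P: "P = smult c J" unfolding P_def chebyshev_U_def c_def J_def ..
  have "(1 - x\<^sup>2) * poly (pderiv (pderiv J)) x - 3 * x * poly (pderiv J) x + real n * (real n + 2) * poly J x = 0"
    using jacobi_equation[of "1/2" x "1/2" n] by (simp add: J_def power2_eq_square algebra_simps)
  then have "c * ((1 - x\<^sup>2) * poly (pderiv (pderiv J)) x - 3 * x * poly (pderiv J) x + real n * (real n + 2) * poly J x) = 0"
    by simp
  then show ?thesis by (simp add: P pderiv_smult algebra_simps)
qed

lemma chebyshev_T_at_1: "poly (chebyshev_T n) 1 = 1"
proof -
  have "Gamma (real n + 1/2) > 0" by (rule Gamma_real_pos) simp
  then have "Gamma (real n + 1/2) \<noteq> 0" by linarith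
  then show ?thesis
    by (simp add: chebyshev_T_def poly_jacobi_poly_1 Gamma_one_half_real add_ac)
qed

lemma chebyshev_U_at_1: "poly (chebyshev_U n) 1 = real n + 1"
proof -
  have "2 * Gamma (3/2 :: real) = sqrt pi"
  proof -
    have "(1/2 :: real) \<notin> \<int>\<^sub>\<le>\<^sub>0" using nonpos_Ints_nonpos[of "1/2 :: real"] by auto
    from Gamma_plus1[OF this] show ?thesis by (simp add: Gamma_one_half_real)
  qed
  moreover have "Gamma (real n + 3/2) > 0" by (rule Gamma_real_pos) simp
  then have "Gamma (real n + 3/2) \<noteq> 0" by linarith
  ultimately show ?thesis
    by (simp add: chebyshev_U_def poly_jacobi_poly_1 add_ac)
qed

text \<open>
  As a function of \<open>t\<close>, \<open>T\<^sub>n (cos t)\<close> is a harmonic oscillator of frequency \<open>n\<close>, with value \<open>1\<close> and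
  derivative \<open>0\<close> at \<open>t = 0\<close>.
\<close>

lemma chebyshev_T_cos:
  assumes "n > 0"
  shows "poly (chebyshev_T n) (cos \<theta>) = cos (real n * \<theta>)"
proof -
  define P where "P = chebyshev_T n"
  define u where "u t = poly P (cos t)" for t
  define u' where "u' t = - sin t * poly (pderiv P) (cos t)" for t
  have "(u has_real_derivative u' t) (at t)" for t
    unfolding u_def u'_def by (auto intro!: derivative_eq_intros)
  moreover have "(u' has_real_derivative - (real n)\<^sup>2 * u t) (at t)" for t
  proof -
    have "(u' has_real_derivative (sin t)\<^sup>2 * poly (pderiv (pderiv P)) (cos t) - cos t * poly (pderiv P) (cos t)) (at t)"
      unfolding u'_def by (auto intro!: derivative_eq_intros simp: power2_eq_square)
    also have "(sin t)\<^sup>2 * poly (pderiv (pderiv P)) (cos t) - cos t * poly (pderiv P) (cos t) = - (real n)\<^sup>2 * u t"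
      using chebyshev_T_equation[of "cos t" n] by (simp add: u_def P_def sin_squared_eq)
    finally show ?thesis .
  qed
  ultimately show ?thesis
    using harmonic_oscillator[of "real n" u u' \<theta>] assms
    by (simp add: u_def u'_def P_def chebyshev_T_at_1)
qed

text \<open>
  The factor \<open>sin t\<close> removes the first-order term of the differential equation and leaves a harmonic
  oscillator of frequency \<open>n + 1\<close>, with value \<open>0\<close> and derivative \<open>U\<^sub>n 1 = n + 1\<close> at \<open>t = 0\<close>.
\<close>

lemma chebyshev_U_cos: "sin \<theta> * poly (chebyshev_U n) (cos \<theta>) = sin ((real n + 1) * \<theta>)"
proof -
  define P where "P = chebyshev_U n"
  define u where "u t = sin t * poly P (cos t)" for t
  define u' where "u' t = cos t * poly P (cos t) - (sin t)\<^sup>2 * poly (pderiv P) (cos t)" for t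
  have "(u has_real_derivative u' t) (at t)" for t
    unfolding u_def u'_def by (auto intro!: derivative_eq_intros simp: power2_eq_square)
  moreover have "(u' has_real_derivative - (real n + 1)\<^sup>2 * u t) (at t)" for t
  proof -
    have "(u' has_real_derivative sin t * ((1 - (cos t)\<^sup>2) * poly (pderiv (pderiv P)) (cos t)
        - 3 * cos t * poly (pderiv P) (cos t) - poly P (cos t))) (at t)"
      unfolding u'_def sin_squared_eq[symmetric]
      by (auto intro!: derivative_eq_intros simp: power2_eq_square algebra_simps)
    also have "(1 - (cos t)\<^sup>2) * poly (pderiv (pderiv P)) (cos t)
        - 3 * cos t * poly (pderiv P) (cos t) - poly P (cos t) = - (real n + 1)\<^sup>2 * poly P (cos t)"
      using chebyshev_U_equation[of "cos t" n] unfolding P_def by algebra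
    finally show ?thesis by (simp add: u_def mult_ac)
  qed
  ultimately show ?thesis
    using harmonic_oscillator[of "real n + 1" u u' \<theta>]
    by (simp add: u_def u'_def P_def chebyshev_U_at_1)
qed

section \<open>Legendre polynomials at the origin\<close>

lemma legendre_coeff:
  "jacobi_coeff 0 0 n k = pochhammer (- real n) k * pochhammer (real n + 1) k / (fact k)\<^sup>2"
  by (simp add: jacobi_coeff_def pochhammer_fact[symmetric] power2_eq_square)

text \<open>
  All four coefficients are multiples, by factors polynomial in \<open>n\<close> and \<open>k\<close>, of
  \<open>g = pochhammer (- n - 1) k * pochhammer (n + 2) k\<close>, up to the common denominator; what
  remains is a polynomial identity.
\<close>

lemma legendre_coeff_recurrence:
  "(real n + 2) * jacobi_coeff 0 0 (n + 2) (Suc k)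
    = (2 * real n + 3) * (jacobi_coeff 0 0 (n + 1) (Suc k) - 2 * jacobi_coeff 0 0 (n + 1) k)
      - (real n + 1) * jacobi_coeff 0 0 n (Suc k)"
proof -
  define z where "z = real n"
  define d where "d = (fact k :: real)"
  define g where "g = pochhammer (- z - 1) k * pochhammer (z + 2) k"
  have d: "d > 0" "fact (Suc k) = (real k + 1) * d" by (simp_all add: d_def algebra_simps)
  have z: "z + 1 \<noteq> 0" "z + 2 \<noteq> 0" by (simp_all add: z_def)
  have p1: "pochhammer (- z) (Suc k) * (- z - 1) = pochhammer (- z - 1) k * (real k - z - 1) * (real k - z)"
  proof -
    have "pochhammer (- z - 1) (Suc (Suc k)) = (- z - 1) * pochhammer (- z) (Suc k)"
      using pochhammer_rec[of "- z - 1" "Suc k"] by simp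
    moreover have "pochhammer (- z - 1) (Suc (Suc k)) = (real k - z) * pochhammer (- z - 1) (Suc k)"
      using pochhammer_rec'[of "- z - 1" "Suc k"] by simp
    moreover have "pochhammer (- z - 1) (Suc k) = (real k - z - 1) * pochhammer (- z - 1) k"
      using pochhammer_rec'[of "- z - 1" k] by simp
    ultimately show ?thesis by algebra
  qed
  have p2: "pochhammer (z + 1) (Suc k) = (z + 1) * pochhammer (z + 2) k"
    using pochhammer_rec[of "z + 1" k] by (simp add: add_ac)
  have p3: "pochhammer (- (z + 2)) (Suc k) = - (z + 2) * pochhammer (- z - 1) k"
  proof -
    have "- (z + 2) + 1 = - z - 1" by simp
    then show ?thesis by (simp only: pochhammer_rec)
  qed
  have p4: "(z + 2) * pochhammer (z + 3) (Suc k) = pochhammer (z + 2) k * (z + 2 + k) * (z + 3 + k)"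
  proof -
    have "pochhammer (z + 2) (Suc (Suc k)) = (z + 2) * pochhammer (z + 3) (Suc k)"
      using pochhammer_rec[of "z + 2" "Suc k"] by (simp add: add_ac)
    moreover have "pochhammer (z + 2) (Suc (Suc k)) = (z + 3 + real k) * pochhammer (z + 2) (Suc k)"
      using pochhammer_rec'[of "z + 2" "Suc k"] by (simp add: add_ac)
    moreover have "pochhammer (z + 2) (Suc k) = (z + 2 + real k) * pochhammer (z + 2) k"
      using pochhammer_rec'[of "z + 2" k] by simp
    ultimately show ?thesis by algebra
  qed
  have c0: "jacobi_coeff 0 0 n (Suc k) = - (g * (real k - z - 1) * (real k - z)) / ((real k + 1) * d)\<^sup>2"
  proof -
    have "pochhammer (- z) (Suc k) * pochhammer (z + 1) (Suc k) = - (g * (real k - z - 1) * (real k - z))"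
      using p1 unfolding p2 g_def by algebra
    then show ?thesis
      unfolding legendre_coeff d z_def[symmetric] by simp
  qed
  have z1: "- real (n + 1) = - z - 1" "real (n + 1) + 1 = z + 2"
    and z2: "- real (n + 2) = - (z + 2)" "real (n + 2) + 1 = z + 3"
    by (simp_all add: z_def)
  have c1: "jacobi_coeff 0 0 (n + 1) k = g / d\<^sup>2"
    unfolding legendre_coeff z1 g_def d_def ..
  have c1': "jacobi_coeff 0 0 (n + 1) (Suc k) = g * (real k - z - 1) * (real k + z + 2) / ((real k + 1) * d)\<^sup>2"
    unfolding legendre_coeff d z1 g_def pochhammer_rec' by (simp add: algebra_simps)
  have c2: "jacobi_coeff 0 0 (n + 2) (Suc k) = - (g * (z + 2 + k) * (z + 3 + k)) / ((real k + 1) * d)\<^sup>2"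
  proof -
    have "pochhammer (- (z + 2)) (Suc k) * pochhammer (z + 3) (Suc k) = - (g * (z + 2 + k) * (z + 3 + k))"
      using p4 unfolding p3 g_def by algebra
    then show ?thesis
      unfolding legendre_coeff d z2 by simp
  qed
  show ?thesis
    unfolding c0 c1 c1' c2 using d(1) unfolding z_def[symmetric] 
    by (simp add: divide_simps) (simp add: algebra_simps power2_eq_square)
qed

lemma legendre_recurrence:
  "smult (real n + 2) (legendre_poly (n + 2))
    = smult (2 * real n + 3) ([:0, 1:] * legendre_poly (n + 1)) - smult (real n + 1) (legendre_poly n)"
proof -
  define F where "F = jacobi_series 0 0"
  have leg: "legendre_poly n = pcompose (F n) [:1/2, -1/2:]" for n
    by (simp add: legendre_poly_def jacobi_poly_eq_pcompose F_def pochhammer_fact[symmetric])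
  have "smult (real n + 2) (F (n + 2)) = smult (2 * real n + 3) ([:1, -2:] * F (n + 1)) - smult (real n + 1) (F n)"
  proof (rule poly_eqI)
    fix k
    show "coeff (smult (real n + 2) (F (n + 2))) k
      = coeff (smult (2 * real n + 3) ([:1, -2:] * F (n + 1)) - smult (real n + 1) (F n)) k"
    proof (cases k)
      case 0
      then show ?thesis by (simp add: F_def coeff_jacobi_series jacobi_coeff_def)
    next
      case (Suc j)
      then show ?thesis using legendre_coeff_recurrence[of n j]
        by (simp add: F_def coeff_jacobi_series)
    qed
  qed
  from arg_cong[OF this, of "\<lambda>p. pcompose p [:1/2, -1/2:]"]
  have "smult (real n + 2) (legendre_poly (n + 2)) = smult (2 * real n + 3)
      (pcompose [:1, -2:] [:1/2, -1/2:] * legendre_poly (n + 1)) - smult (real n + 1) (legendre_poly n)"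
    by (simp only: leg pcompose_smult pcompose_diff pcompose_mult)
  also have "pcompose [:1, -2:] [:1/2, -1/2:] = [:0, 1 :: real:]"
    by (simp add: pcompose_pCons)
  finally show ?thesis .
qed

lemma legendre_poly_0: "legendre_poly 0 = 1"
  by (simp add: legendre_poly_def jacobi_poly_def)

lemma legendre_poly_1: "legendre_poly (Suc 0) = [:0, 1:]"
  by (simp add: legendre_poly_def jacobi_poly_def pochhammer_Suc numeral_eq_Suc one_pCons)

text \<open>
  This is \<open>2 / \<pi>\<close> times the integral of \<open>(sin t)\<^sup>n\<close> over \<open>[0, \<pi> / 2]\<close>, written with the Gamma
  function. For even \<open>n\<close> it equals \<open>\<bar>P\<^sub>n 0\<bar>\<close>; its values at odd \<open>n\<close> interpolate, which is
  what Wallis' argument needs.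
\<close>

definition wallis_ratio :: "nat \<Rightarrow> real" where
  "wallis_ratio n = Gamma ((real n + 1) / 2) / (sqrt pi * Gamma (real n / 2 + 1))"

lemma wallis_ratio_pos: "wallis_ratio n > 0"
  by (simp add: wallis_ratio_def Gamma_real_pos)

lemma wallis_ratio_mult_Suc: "wallis_ratio n * wallis_ratio (Suc n) = 2 / (pi * (real n + 1))"
proof -
  have "Gamma ((real n + 1) / 2 + 1) = (real n + 1) / 2 * Gamma ((real n + 1) / 2)"
    by (rule Gamma_plus1) (auto simp: add_nonneg_eq_0_iff elim!: nonpos_Ints_cases)
  moreover have "(real (Suc n) + 1) / 2 = real n / 2 + 1" "real (Suc n) / 2 + 1 = (real n + 1) / 2 + 1"
    by (simp_all add: field_simps)
  ultimately have Suc_n: "wallis_ratio (Suc n)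
      = Gamma (real n / 2 + 1) / (sqrt pi * ((real n + 1) / 2 * Gamma ((real n + 1) / 2)))"
    by (simp only: wallis_ratio_def)
  have cancel: "G1 / (s * G2) * (G2 / (s * (z / 2 * G1))) = 2 / (s * s * z)"
    if "G1 > 0" "G2 > 0" for G1 G2 s z :: real
    using that by (simp add: field_simps)
  have "wallis_ratio n * wallis_ratio (Suc n) = 2 / (sqrt pi * sqrt pi * (real n + 1))"
    unfolding Suc_n wallis_ratio_def[of n] by (rule cancel) (simp_all add: Gamma_real_pos)
  then show ?thesis by simp
qed

lemma wallis_ratio_Suc_Suc: "(real n + 2) * wallis_ratio (n + 2) = (real n + 1) * wallis_ratio n"
proof -
  have "(real n + 1) * (wallis_ratio n * wallis_ratio (Suc n)) = 2 / pi"
    unfolding wallis_ratio_mult_Suc by (simp add: divide_simps)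
  moreover have "(real (Suc n) + 1) * (wallis_ratio (Suc n) * wallis_ratio (Suc (Suc n))) = 2 / pi"
    unfolding wallis_ratio_mult_Suc by (simp add: divide_simps)
  ultimately have "wallis_ratio (Suc n) * ((real n + 2) * wallis_ratio (n + 2))
      = wallis_ratio (Suc n) * ((real n + 1) * wallis_ratio n)"
    by (simp add: algebra_simps)
  then show ?thesis using wallis_ratio_pos[of "Suc n"] by simp
qed

text \<open>
  Log-convexity of the Gamma function at the midpoint of \<open>x\<close> and \<open>x + 1\<close>, where \<open>x = (n + 1) / 2\<close>.
\<close>

lemma wallis_ratio_Suc_le: "wallis_ratio (Suc n) \<le> wallis_ratio n"
proof -
  define x where "x = (real n + 1) / 2"
  have x: "x > 0" by (simp add: x_def)
  then have G: "Gamma x > 0" "Gamma (x + 1) > 0" "Gamma (x + 1 / 2) > 0" by (simp_all add: Gamma_real_pos)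
  have "(ln \<circ> Gamma) ((1 - 1/2) *\<^sub>R x + (1/2) *\<^sub>R (x + 1)) \<le> (1 - 1/2) * (ln \<circ> Gamma) x + (1/2) * (ln \<circ> Gamma) (x + 1)"
    using x by (intro convex_onD[OF log_convex_Gamma_real]) auto
  moreover have "(1 - 1/2) *\<^sub>R x + (1/2) *\<^sub>R (x + 1) = x + 1 / 2" by (simp add: field_simps)
  ultimately have "2 * ln (Gamma (x + 1/2)) \<le> ln (Gamma x) + ln (Gamma (x + 1))" by simp
  then have "ln (Gamma (x + 1/2) * Gamma (x + 1/2)) \<le> ln (Gamma x * Gamma (x + 1))"
    using G by (simp add: ln_mult)
  then have "Gamma (x + 1/2) * Gamma (x + 1/2) \<le> Gamma x * Gamma (x + 1)" using G by simp
  then have "Gamma (x + 1/2) / Gamma (x + 1) \<le> Gamma x / Gamma (x + 1/2)" using G by (simp add: field_simps)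
  moreover have "(real (Suc n) + 1) / 2 = x + 1 / 2" "real (Suc n) / 2 + 1 = x + 1" "(real n + 1) / 2 = x" "real n / 2 + 1 = x + 1/2"
    by (simp_all add: x_def field_simps)
  moreover have "wallis_ratio (Suc n) = Gamma (x + 1/2) / (sqrt pi * Gamma (x + 1))"
    "wallis_ratio n = Gamma x / (sqrt pi * Gamma (x + 1/2))"
    by (simp_all only: wallis_ratio_def calculation(2-))
  ultimately show ?thesis
    using divide_right_mono[of "Gamma (x + 1/2) / Gamma (x + 1)" "Gamma x / Gamma (x + 1/2)" "sqrt pi"]
    by (simp add: mult_ac)
qed

text \<open>
  Wallis' argument: the ratio \<open>w\<close> is decreasing and the products \<open>w n * w (n + 1)\<close> are
  known exactly, so \<open>(w n)\<^sup>2\<close> lies between \<open>2 / (\<pi> (n + 1))\<close> and \<open>2 / (\<pi> n)\<close>.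
\<close>

lemma wallis_ratio_asymptotics: "(\<lambda>n. sqrt (real n) * wallis_ratio n) \<longlonglongrightarrow> sqrt (2 / pi)"
proof -
  have "(\<lambda>n. real n * (wallis_ratio n)\<^sup>2) \<longlonglongrightarrow> 2 / pi"
  proof (rule tendsto_sandwich)
    show "eventually (\<lambda>n. real n * (2 / (pi * (real n + 1))) \<le> real n * (wallis_ratio n)\<^sup>2) sequentially"
    proof (intro always_eventually allI mult_left_mono)
      show "2 / (pi * (real n + 1)) \<le> (wallis_ratio n)\<^sup>2" for n
        unfolding wallis_ratio_mult_Suc[symmetric] power2_eq_square
        using wallis_ratio_Suc_le[of n] wallis_ratio_pos[of n] by (intro mult_left_mono) auto
    qed simp
    show "eventually (\<lambda>n. real n * (wallis_ratio n)\<^sup>2 \<le> 2 / pi) sequentially"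
    proof (intro always_eventually allI)
      show "real n * (wallis_ratio n)\<^sup>2 \<le> 2 / pi" for n
      proof (cases n)
        case (Suc m)
        have "(wallis_ratio n)\<^sup>2 \<le> wallis_ratio m * wallis_ratio n"
          using wallis_ratio_Suc_le[of m] wallis_ratio_pos[of n] unfolding Suc power2_eq_square by (intro mult_right_mono) auto
        also have "\<dots> = 2 / pi / real n" by (simp add: wallis_ratio_mult_Suc Suc)
        finally show ?thesis by (simp add: Suc pos_le_divide_eq mult.commute)
      qed simp
    qed
    show "(\<lambda>n. real n * (2 / (pi * (real n + 1)))) \<longlonglongrightarrow> 2 / pi"
    proof -
      have "(\<lambda>n. 2 / pi * (real n / (real n + 1))) \<longlonglongrightarrow> 2 / pi * 1"
        by (intro tendsto_mult tendsto_const) real_asymp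
      then show ?thesis by (simp add: mult.commute)
    qed
  qed simp
  from tendsto_real_sqrt[OF this] show ?thesis
    using wallis_ratio_pos by (simp add: real_sqrt_mult less_imp_le)
qed

text \<open>
  The cosine is the sign pattern \<open>1, 0, -1, 0\<close>. With it even and odd degrees need not be separated, and
  the addition theorem later turns it into the phase shift of the Laplace formula.
\<close>

lemma legendre_poly_at_0: "poly (legendre_poly n) 0 = cos (real n * pi / 2) * wallis_ratio n"
proof (induction n rule: induct_nat_012)
  case 0
  then show ?case by (simp add: legendre_poly_0 wallis_ratio_def Gamma_one_half_real)
next
  case 1
  then show ?case by (simp add: legendre_poly_1)
next
  case (ge2 n)
  have "(real n + 2) * poly (legendre_poly (n + 2)) 0 = - ((real n + 1) * poly (legendre_poly n) 0)"
    using arg_cong[OF legendre_recurrence[of n], of "\<lambda>p. poly p 0"] by simp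
  also have "\<dots> = - cos (real n * pi / 2) * ((real n + 2) * wallis_ratio (n + 2))"
    using wallis_ratio_Suc_Suc[of n] by (simp add: ge2)
  also have "- cos (real n * pi / 2) = cos (real (n + 2) * pi / 2)"
  proof -
    have "real (n + 2) * pi / 2 = real n * pi / 2 + pi" by (simp add: field_simps)
    then show ?thesis by (simp only: cos_periodic_pi)
  qed
  finally show ?case by simp
qed

text \<open>
  Differentiating the three-term recurrence at \<open>0\<close> makes the value \<open>P\<^sub>n 0\<close> appear from the factor \<open>x\<close>; the recurrence
  for the values at \<open>0\<close> then closes the induction.
\<close>

lemma pderiv_legendre_poly_at_0:
  "poly (pderiv (legendre_poly (Suc n))) 0 = (real n + 1) * poly (legendre_poly n) 0"
proof (induction n rule: induct_nat_012)
  case 0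
  then show ?case by (simp add: legendre_poly_0 legendre_poly_1 pderiv_pCons)
next
  case 1
  show ?case using arg_cong[OF legendre_recurrence[of 0], of "\<lambda>p. poly (pderiv p) 0"]
    by (simp add: legendre_poly_0 legendre_poly_1 pderiv_pCons numeral_2_eq_2 pderiv_smult pderiv_mult)
next
  case (ge2 n)
  have "(real n + 3) * poly (pderiv (legendre_poly (n + 3))) 0
      = (2 * real n + 5) * poly (legendre_poly (n + 2)) 0 - (real n + 2) * poly (pderiv (legendre_poly (n + 1))) 0"
    using arg_cong[OF legendre_recurrence[of "Suc n"], of "\<lambda>p. poly (pderiv p) 0"]
    by (simp add: pderiv_smult pderiv_diff pderiv_mult pderiv_pCons numeral_eq_Suc algebra_simps)
  also have "(real n + 2) * poly (pderiv (legendre_poly (n + 1))) 0 = (real n + 2) * ((real n + 1) * poly (legendre_poly n) 0)"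
    using ge2 by simp
  also have "(real n + 1) * poly (legendre_poly n) 0 = - ((real n + 2) * poly (legendre_poly (n + 2)) 0)"
    using arg_cong[OF legendre_recurrence[of n], of "\<lambda>p. poly p 0"] by simp
  finally have "(real n + 3) * poly (pderiv (legendre_poly (n + 3))) 0 = (real n + 3) * ((real n + 3) * poly (legendre_poly (n + 2)) 0)"
    by algebra
  then have "poly (pderiv (legendre_poly (n + 3))) 0 = (real n + 3) * poly (legendre_poly (n + 2)) 0"
    by (subst (asm) mult_cancel_left) auto
  then show ?case by (simp add: numeral_eq_Suc)
qed

section \<open>The Laplace asymptotics of Legendre polynomials\<close>

lemma legendre_equation:
  fixes n :: nat and x :: real
  defines "P \<equiv> legendre_poly n"
  shows "(1 - x\<^sup>2) * poly (pderiv (pderiv P)) x - 2 * x * poly (pderiv P) x + real n * (real n + 1) * poly P x = 0"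
  using jacobi_equation[of 0 x 0 n] by (simp add: P_def legendre_poly_def algebra_simps)

text \<open>
  The factor \<open>sqrt (sin t)\<close> removes the first-order term from the Legendre equation in the variable \<open>t\<close>
  (Liouville's transformation); \<open>1 / (4 (sin t)\<^sup>2)\<close> is the potential that it leaves behind.
\<close>

lemma legendre_oscillator:
  fixes n :: nat
  defines "P \<equiv> legendre_poly n"
  defines "u \<equiv> \<lambda>t. sqrt (sin t) * poly P (cos t)"
  defines "u' \<equiv> \<lambda>t. cos t / (2 * sqrt (sin t)) * poly P (cos t) - sqrt (sin t) * sin t * poly (pderiv P) (cos t)"
  assumes t: "0 < t" "t < pi"
  shows "(u has_real_derivative u' t) (at t)"
    and "(u' has_real_derivative - ((real n + 1/2)\<^sup>2 + 1 / (4 * (sin t)\<^sup>2)) * u t) (at t)"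
proof -
  define r where "r = sqrt (sin t)"
  define c where "c = cos t"
  have s: "sin t > 0" using t by (rule sin_gt_zero)
  have r: "r > 0" "sin t = r\<^sup>2" using s by (simp_all add: r_def)
  have u: "r * poly P c = u t" by (simp add: u_def r_def c_def)
  have r4: "r ^ 4 = 1 - c\<^sup>2" using sin_squared_eq[of t] by (simp add: r(2) c_def)
  show "(u has_real_derivative u' t) (at t)"
    unfolding u_def u'_def using s by (auto intro!: derivative_eq_intros simp: field_simps)
  define p0 p1 p2 where p: "p0 = poly P c" "p1 = poly (pderiv P) c" "p2 = poly (pderiv (pderiv P)) c"
  have ode: "r ^ 4 * p2 - 2 * c * p1 + real n * (real n + 1) * p0 = 0"
    using legendre_equation[of c n] unfolding P_def[symmetric] p[symmetric] r4 .
  have "(u' has_real_derivative 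
      (- r\<^sup>2 * (2 * r) - c * (2 * (c / (2 * r)))) / (2 * r)\<^sup>2 * p0 + c / (2 * r) * (- r\<^sup>2 * p1)
      - ((c / (2 * r) * r\<^sup>2 + r * c) * p1 + r * r\<^sup>2 * (- r\<^sup>2 * p2))) (at t)"
  proof -
    define R where "R = (\<lambda>t. sqrt (sin t))"
    have dR: "(R has_real_derivative c / (2 * r)) (at t)"
      unfolding R_def c_def r_def using s by (auto intro!: derivative_eq_intros simp: field_simps)
    have Rt: "R t = r" by (simp add: R_def r_def)
    have "u' = (\<lambda>t. cos t / (2 * R t) * poly P (cos t) - R t * sin t * poly (pderiv P) (cos t))"
      by (simp add: u'_def R_def)
    then show ?thesis
      using r(1) by (auto intro!: derivative_eq_intros dR
        simp: Rt p[symmetric] c_def[symmetric] r(2) power2_eq_square) (simp add: field_simps)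
  qed
  also have "(- r\<^sup>2 * (2 * r) - c * (2 * (c / (2 * r)))) / (2 * r)\<^sup>2 = - (r / 2 + c\<^sup>2 * (1 / (4 * r ^ 3)))"
    using r(1) by (simp add: field_simps power2_eq_square power3_eq_cube)
  also have "c / (2 * r) * (- r\<^sup>2 * p1) = - (c * r / 2) * p1"
    using r(1) by (simp add: power2_eq_square)
  also have "c / (2 * r) * r\<^sup>2 = c * r / 2"
    using r(1) by (simp add: power2_eq_square)
  also have "- (r / 2 + c\<^sup>2 * (1 / (4 * r ^ 3))) * p0 + - (c * r / 2) * p1 - ((c * r / 2 + r * c) * p1 + r * r\<^sup>2 * (- r\<^sup>2 * p2))
     = r * (r ^ 4 * p2 - 2 * c * p1) - (r / 2 + c\<^sup>2 * (1 / (4 * r ^ 3))) * p0"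
    by (simp add: algebra_simps power2_eq_square power4_eq_xxxx)
  also have "r ^ 4 * p2 - 2 * c * p1 = - (real n * (real n + 1)) * p0" using ode by simp
  also have "c\<^sup>2 = 1 - r ^ 4" using r4 by simp
  also have "(1 - r ^ 4) * (1 / (4 * r ^ 3)) = r / (4 * (r\<^sup>2)\<^sup>2) - r / 4"
    using r(1) by (simp add: field_simps power2_eq_square power3_eq_cube power4_eq_xxxx)
  also have "r * (- (real n * (real n + 1)) * p0) - (r / 2 + (r / (4 * (r\<^sup>2)\<^sup>2) - r / 4)) * p0
    = - ((real n + 1/2)\<^sup>2 + 1 / (4 * (r\<^sup>2)\<^sup>2)) * (r * poly P c)"
    by (simp add: p algebra_simps power2_eq_square)
  finally show "(u' has_real_derivative - ((real n + 1/2)\<^sup>2 + 1 / (4 * (sin t)\<^sup>2)) * u t) (at t)"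
    by (simp only: r(2)[symmetric] u)
qed
text \<open>
  On the interval between \<open>\<theta>\<close> and \<open>\<pi> / 2\<close> the potential \<open>1 / (4 (sin t)\<^sup>2)\<close> is bounded
  independently of \<open>n\<close>, so the error of the unperturbed solution started at \<open>\<pi> / 2\<close> is smaller than the
  solution by a factor of order \<open>1 / n\<close>. The initial data at \<open>\<pi> / 2\<close> are \<open>P\<^sub>n 0\<close> and
  \<open>- P\<^sub>n' 0 = - n P\<^sub>n\<^sub>-\<^sub>1 0\<close>, which are of size \<open>sqrt (2 / (\<pi> n))\<close> and \<open>n sqrt (2 / (\<pi> n))\<close> up to
  the factors \<open>cos (n \<pi> / 2)\<close> and \<open>sin (n \<pi> / 2)\<close>.
\<close>

lemma legendre_asymptotics:
  fixes \<theta> :: real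
  assumes \<theta>: "0 < \<theta>" "\<theta> < pi"
  shows "(\<lambda>n. sqrt (real n) * (sqrt (sin \<theta>) * poly (legendre_poly n) (cos \<theta>))
    - sqrt (2 / pi) * cos (real n * \<theta> + (\<theta> / 2 - pi / 4))) \<longlonglongrightarrow> 0"
proof -
  define l where "l = min \<theta> (pi / 2)"
  define r where "r = max \<theta> (pi / 2)"
  have lr: "0 < l" "r < pi" "\<theta> \<in> {l..r}" "pi / 2 \<in> {l..r}" using \<theta> by (auto simp: l_def r_def)
  have inside: "0 < t" "t < pi" if "t \<in> {l..r}" for t using that lr by auto
  have "continuous_on {l..r} (\<lambda>t. 1 / (4 * (sin t)\<^sup>2))"
    using sin_gt_zero[OF inside] by (intro continuous_intros) force
  then have "bounded ((\<lambda>t. 1 / (4 * (sin t)\<^sup>2)) ` {l..r})"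
    by (intro compact_imp_bounded compact_continuous_image) auto
  then obtain K where K: "\<And>t. t \<in> {l..r} \<Longrightarrow> \<bar>1 / (4 * (sin t)\<^sup>2)\<bar> \<le> K"
    unfolding bounded_iff real_norm_def by (meson imageI)
  \<comment> \<open>The degree is \<open>Suc n\<close> from here on; \<open>X n\<close> and \<open>Y n\<close> are \<open>P 0\<close> and \<open>P' 0 / \<nu>\<close>, rescaled by \<open>sqrt (Suc n)\<close> and stripped of their factors \<open>cos (Suc n * \<pi> / 2)\<close> and \<open>sin (Suc n * \<pi> / 2)\<close>.\<close>
  define X where "X n = sqrt (real (Suc n)) * wallis_ratio (Suc n)" for n
  define Y where "Y n = (real n + 1) / (real n + 3 / 2) * (sqrt (real (Suc n)) * wallis_ratio n)" for n
  have X: "X \<longlonglongrightarrow> sqrt (2 / pi)"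
    unfolding X_def[abs_def] by (rule LIMSEQ_Suc[OF wallis_ratio_asymptotics])
  have Y: "Y \<longlonglongrightarrow> sqrt (2 / pi)"
  proof -
    have "(\<lambda>n. (real n + 1) / (real n + 3 / 2) * sqrt (real (Suc n) / real n) * (sqrt (real n) * wallis_ratio n))
        \<longlonglongrightarrow> 1 * sqrt (2 / pi)"
      by (intro tendsto_mult wallis_ratio_asymptotics) real_asymp
    moreover have "eventually (\<lambda>n. (real n + 1) / (real n + 3 / 2) * sqrt (real (Suc n) / real n) * (sqrt (real n) * wallis_ratio n) = Y n) sequentially"
      using eventually_gt_at_top[of 0] by eventually_elim (simp add: Y_def real_sqrt_divide)
    ultimately show ?thesis by (simp add: tendsto_cong)
  qed
  \<comment> \<open>The frequency \<open>\<nu> n\<close> is \<open>Suc n + 1 / 2\<close>.\<close>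
  define u where "u n = sqrt (sin \<theta>) * poly (legendre_poly (Suc n)) (cos \<theta>)" for n
  define \<nu> where "\<nu> n = real n + 3 / 2" for n
  define C where "C n = cos (real (Suc n) * pi / 2) * cos (\<nu> n * (\<theta> - pi / 2))" for n
  define S where "S n = sin (real (Suc n) * pi / 2) * sin (\<nu> n * (\<theta> - pi / 2))" for n
  have phase: "C n - S n = cos (real (Suc n) * \<theta> + (\<theta> / 2 - pi / 4))" for n
  proof -
    have "real (Suc n) * pi / 2 + \<nu> n * (\<theta> - pi / 2) = real (Suc n) * \<theta> + (\<theta> / 2 - pi / 4)"
      by (simp add: \<nu>_def field_simps)
    then show ?thesis unfolding C_def S_def cos_add[symmetric] by simp
  qed
  have err: "eventually (\<lambda>n. \<bar>sqrt (real (Suc n)) * u n - (X n * C n - Y n * S n)\<bar>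
      \<le> 2 * K * (r - l) / \<nu> n * (X n + Y n)) sequentially"
  proof -
    have "eventually (\<lambda>n. 2 * K * (r - l) \<le> \<nu> n) sequentially"
    proof -
      have "filterlim \<nu> at_top sequentially" unfolding \<nu>_def[abs_def] by real_asymp
      then show ?thesis by (simp add: filterlim_at_top)
    qed
    then show ?thesis
    proof eventually_elim
      case (elim n)
      define s where "s = sqrt (real (Suc n))"
      define P where "P = legendre_poly (Suc n)"
      have \<nu>: "\<nu> n > 0" "real (Suc n) + 1 / 2 = \<nu> n" by (simp_all add: \<nu>_def)
      have s: "s \<ge> 0" by (simp add: s_def)
      have "cos (real n * pi / 2) = sin (real (Suc n) * pi / 2)"
      proof -
        have "real (Suc n) * pi / 2 = real n * pi / 2 + pi / 2" by (simp add: field_simps)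
        then show ?thesis by (simp only: sin_add) simp
      qed
      then have s0: "s * poly P 0 = cos (real (Suc n) * pi / 2) * X n"
        and s1: "s * (poly (pderiv P) 0 / \<nu> n) = sin (real (Suc n) * pi / 2) * Y n"
        by (simp_all add: P_def s_def X_def Y_def \<nu>_def legendre_poly_at_0 pderiv_legendre_poly_at_0 mult_ac del: of_nat_Suc)
      have XY: "X n \<ge> 0" "Y n \<ge> 0" using wallis_ratio_pos by (simp_all add: X_def Y_def less_imp_le)
      have "\<bar>u n - (poly P 0 * cos (\<nu> n * (\<theta> - pi / 2)) + - poly (pderiv P) 0 / \<nu> n * sin (\<nu> n * (\<theta> - pi / 2)))\<bar>
          \<le> 2 * K * (r - l) / \<nu> n * (\<bar>poly P 0\<bar> + \<bar>- poly (pderiv P) 0\<bar> / \<nu> n)"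
        using perturbed_oscillator_self_bounded[OF \<nu>(1) elim
            legendre_oscillator(1)[of _ "Suc n"] legendre_oscillator(2)[of _ "Suc n", unfolded \<nu>(2)] K lr(4) lr(3)] inside
        by (simp add: u_def P_def)
      then have "s * \<bar>u n - (poly P 0 * cos (\<nu> n * (\<theta> - pi / 2)) + - poly (pderiv P) 0 / \<nu> n * sin (\<nu> n * (\<theta> - pi / 2)))\<bar>
          \<le> s * (2 * K * (r - l) / \<nu> n * (\<bar>poly P 0\<bar> + \<bar>- poly (pderiv P) 0\<bar> / \<nu> n))"
        using s by (rule mult_left_mono)
      also have "s * \<bar>u n - (poly P 0 * cos (\<nu> n * (\<theta> - pi / 2)) + - poly (pderiv P) 0 / \<nu> n * sin (\<nu> n * (\<theta> - pi / 2)))\<bar>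
          = \<bar>s * u n - (X n * C n - Y n * S n)\<bar>"
      proof -
        have "s * \<bar>z\<bar> = \<bar>s * z\<bar>" for z using s by (simp add: abs_mult)
        moreover have "s * (u n - (poly P 0 * cos (\<nu> n * (\<theta> - pi / 2)) + - poly (pderiv P) 0 / \<nu> n * sin (\<nu> n * (\<theta> - pi / 2))))
            = s * u n - (s * poly P 0 * cos (\<nu> n * (\<theta> - pi / 2)) - s * (poly (pderiv P) 0 / \<nu> n) * sin (\<nu> n * (\<theta> - pi / 2)))"
          by (simp add: algebra_simps)
        ultimately show ?thesis
          unfolding s0 s1 C_def S_def by (simp add: mult_ac)
      qed
      also have "s * (2 * K * (r - l) / \<nu> n * (\<bar>poly P 0\<bar> + \<bar>- poly (pderiv P) 0\<bar> / \<nu> n))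
          \<le> 2 * K * (r - l) / \<nu> n * (X n + Y n)"
      proof -
        have "s * \<bar>poly P 0\<bar> \<le> X n"
        proof -
          have "s * \<bar>poly P 0\<bar> = \<bar>cos (real (Suc n) * pi / 2)\<bar> * X n"
            using arg_cong[OF s0, of abs] s XY by (simp only: abs_mult abs_of_nonneg)
          also have "\<dots> \<le> 1 * X n" using XY by (intro mult_right_mono abs_cos_le_one)
          finally show ?thesis by simp
        qed
        moreover have "s * (\<bar>- poly (pderiv P) 0\<bar> / \<nu> n) \<le> Y n"
        proof -
          have "s * (\<bar>- poly (pderiv P) 0\<bar> / \<nu> n) = \<bar>sin (real (Suc n) * pi / 2)\<bar> * Y n"
            using arg_cong[OF s1, of abs] s XY \<nu>(1)
            by (simp only: abs_mult abs_of_nonneg abs_divide abs_minus less_imp_le)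
          also have "\<dots> \<le> 1 * Y n" using XY by (intro mult_right_mono abs_sin_le_one)
          finally show ?thesis by simp
        qed
        ultimately have "s * (\<bar>poly P 0\<bar> + \<bar>- poly (pderiv P) 0\<bar> / \<nu> n) \<le> X n + Y n"
          by (simp add: distrib_left)
        moreover have "2 * K * (r - l) / \<nu> n \<ge> 0"
          using order.trans[OF abs_ge_zero K[OF lr(3)]] lr(3) \<nu>(1) by simp
        ultimately have "2 * K * (r - l) / \<nu> n * (s * (\<bar>poly P 0\<bar> + \<bar>- poly (pderiv P) 0\<bar> / \<nu> n))
            \<le> 2 * K * (r - l) / \<nu> n * (X n + Y n)"
          by (rule mult_left_mono)
        then show ?thesis by (simp only: mult.left_commute)
      qed
      finally show ?case by (simp add: s_def)
    qed
  qed
  have bound: "(\<lambda>n. 2 * K * (r - l) / \<nu> n * (X n + Y n)) \<longlonglongrightarrow> 0 * (sqrt (2 / pi) + sqrt (2 / pi))"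
    unfolding \<nu>_def by (intro tendsto_mult tendsto_add X Y) real_asymp
  have CS: "\<bar>C n\<bar> \<le> 1" "\<bar>S n\<bar> \<le> 1" for n
    unfolding C_def S_def abs_mult by (intro mult_le_one abs_cos_le_one abs_sin_le_one abs_ge_zero)+
  have "(\<lambda>n. sqrt (real (Suc n)) * u n - (X n * C n - Y n * S n)) \<longlonglongrightarrow> 0"
    by (rule Lim_null_comparison[OF _ bound[unfolded mult_zero_left]]) (use err in \<open>simp only: real_norm_def\<close>)
  moreover have "(\<lambda>n. (X n - sqrt (2 / pi)) * C n) \<longlonglongrightarrow> 0"
    by (rule lim_null_mult_right_bounded[OF LIM_zero[OF X], where B = 1]) (simp add: CS)
  moreover have "(\<lambda>n. (Y n - sqrt (2 / pi)) * S n) \<longlonglongrightarrow> 0"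
    by (rule lim_null_mult_right_bounded[OF LIM_zero[OF Y], where B = 1]) (simp add: CS)
  ultimately have "(\<lambda>n. (sqrt (real (Suc n)) * u n - (X n * C n - Y n * S n))
      + ((X n - sqrt (2 / pi)) * C n - (Y n - sqrt (2 / pi)) * S n)) \<longlonglongrightarrow> 0 + (0 - 0)"
    by (intro tendsto_add tendsto_diff)
  then have "(\<lambda>n. sqrt (real (Suc n)) * u n - sqrt (2 / pi) * (C n - S n)) \<longlonglongrightarrow> 0"
    by (simp add: algebra_simps)
  then show ?thesis
    unfolding phase u_def by (rule LIMSEQ_imp_Suc)
qed

section \<open>Tails of series with oscillating coefficients\<close>

text \<open>
  The tail of \<open>\<Sum>1 / n\<^sup>2\<close> beyond \<open>N\<close> is at most \<open>1 / N\<close>, by comparison with the telescoping series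
  \<open>1 / (n (n - 1))\<close>; a null sequence beats every constant multiple of it.
\<close>

lemma null_tail:
  fixes c :: "nat \<Rightarrow> real"
  assumes "c \<longlonglongrightarrow> 0"
  shows "summable (\<lambda>n. c n / (real n)\<^sup>2)"
    and "(\<lambda>N. real N * (\<Sum>k. c (N + 1 + k) / (real (N + 1 + k))\<^sup>2)) \<longlonglongrightarrow> 0"
proof -
  obtain C where C: "\<And>n. \<bar>c n\<bar> \<le> C"
    using convergent_imp_Bseq[OF convergentI[OF assms]] by (auto simp: Bseq_def)
  have "summable (\<lambda>n. C * inverse ((real n)\<^sup>2))"
    by (intro summable_mult inverse_power_summable) simp
  then show sm: "summable (\<lambda>n. c n / (real n)\<^sup>2)"
    by (rule summable_comparison_test'[where N = 0])
      (use C in \<open>auto simp: field_simps divide_right_mono\<close>)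
  show "(\<lambda>N. real N * (\<Sum>k. c (N + 1 + k) / (real (N + 1 + k))\<^sup>2)) \<longlonglongrightarrow> 0"
  proof (rule LIMSEQ_I)
    fix e :: real assume e: "e > 0"
    obtain M where M: "\<And>n. n \<ge> M \<Longrightarrow> \<bar>c n\<bar> < e / 2"
      using LIMSEQ_D[OF assms, of "e / 2"] e by auto
    have "norm (real N * (\<Sum>k. c (N + 1 + k) / (real (N + 1 + k))\<^sup>2) - 0) < e"
      if N: "N \<ge> max M 1" for N
    proof -
      have tele: "(\<lambda>k. 1 / real (N + k) - 1 / real (N + Suc k)) sums (1 / real (N + 0) - 0)"
        by (rule telescope_sums') real_asymp
      have bd: "norm (c (N + 1 + k) / (real (N + 1 + k))\<^sup>2)
          \<le> e / 2 * (1 / real (N + k) - 1 / real (N + Suc k))" for k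
      proof -
        have "1 / real (N + k) - 1 / real (N + Suc k) = 1 / (real (N + k) * real (N + 1 + k))"
          using N by (simp add: field_simps)
        moreover have "1 / (real (N + 1 + k))\<^sup>2 \<le> 1 / (real (N + k) * real (N + 1 + k))"
          using N by (intro divide_left_mono) (auto simp: power2_eq_square)
        ultimately have "\<bar>c (N + 1 + k)\<bar> * (1 / (real (N + 1 + k))\<^sup>2)
            \<le> e / 2 * (1 / real (N + k) - 1 / real (N + Suc k))"
          using M[of "N + 1 + k"] N e by (intro mult_mono) auto
        then show ?thesis by simp
      qed
      have "norm (\<Sum>k. c (N + 1 + k) / (real (N + 1 + k))\<^sup>2) 
          \<le> (\<Sum>k. e / 2 * (1 / real (N + k) - 1 / real (N + Suc k)))"
        using bd sums_summable[OF tele] by (intro norm_suminf_le summable_mult) auto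
      also have "\<dots> = e / 2 * (1 / real N)"
        using sums_mult[OF tele, of "e / 2"] by (simp add: sums_iff)
      finally have "real N * \<bar>\<Sum>k. c (N + 1 + k) / (real (N + 1 + k))\<^sup>2\<bar> \<le> e / 2"
        using N by (simp add: field_simps)
      then show ?thesis using e N by (simp add: abs_mult)
    qed
    then show "\<exists>M. \<forall>N\<ge>M. norm (real N * (\<Sum>k. c (N + 1 + k) / (real (N + 1 + k))\<^sup>2) - 0) < e"
      by blast
  qed
qed

text \<open>
  Summation by parts. With the partial sums \<open>s\<close> of \<open>a\<close> and \<open>g n = L / n - s n / n\<^sup>2\<close>, the term
  \<open>f n\<close> differs from the telescoping \<open>g n - g (n + 1)\<close> by \<open>o(1 / n\<^sup>2)\<close>. The telescoping tail is \<open>g (N + 1)\<close>,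
  and \<open>N * g (N + 1)\<close> tends to \<open>L\<close> because \<open>s\<close> is bounded.
\<close>

lemma tail_of_bounded_oscillation:
  fixes f a :: "nat \<Rightarrow> real"
  assumes bound: "\<And>n. \<bar>\<Sum>k<n. a k\<bar> \<le> C"
    and close: "(\<lambda>n. (real n)\<^sup>2 * f n - (L + a n)) \<longlonglongrightarrow> 0"
  shows "summable (\<lambda>k. f (N + 1 + k))"
    and "(\<lambda>N. real N * (\<Sum>k. f (N + 1 + k))) \<longlonglongrightarrow> L"
proof -
  define s where "s n = (\<Sum>k<n. a k)" for n
  define g where "g n = L / real n - s n / (real n)\<^sup>2" for n
  define c where "c n = (real n)\<^sup>2 * (f n - (g n - g (Suc n)))" for n
  have sb: "s n / real n \<in> {- C / real n .. C / real n}" for n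
    using bound[of n] by (auto simp: s_def divide_simps abs_le_iff)
  have s0: "(\<lambda>n. s n / real n) \<longlonglongrightarrow> 0"
    by (rule tendsto_sandwich[of "\<lambda>n. - C / real n" _ _ "\<lambda>n. C / real n"])
      (use sb in \<open>auto simp del: divide_minus_left intro!: always_eventually\<close>, real_asymp+)
  have "(\<lambda>n. ((real n)\<^sup>2 * f n - (L + a n)) + L * (1 - real n / (real n + 1))
      + (s (Suc n) / real (Suc n)) * (real n + 1 - (real n)\<^sup>2 / (real n + 1))) \<longlonglongrightarrow> 0 + 0 + 0 * 2"
    by (intro tendsto_intros close LIMSEQ_Suc[OF s0]) real_asymp+
  moreover have "eventually (\<lambda>n. ((real n)\<^sup>2 * f n - (L + a n)) + L * (1 - real n / (real n + 1))
      + (s (Suc n) / real (Suc n)) * (real n + 1 - (real n)\<^sup>2 / (real n + 1)) = c n) sequentially"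
    using eventually_gt_at_top[of 0]
  proof eventually_elim
    case (elim n)
    have "s (Suc n) = s n + a n" by (simp add: s_def)
    then show ?case using elim
      unfolding c_def g_def of_nat_Suc by (simp add: divide_simps) (simp add: algebra_simps power2_eq_square)
  qed
  ultimately have c: "c \<longlonglongrightarrow> 0" by (simp add: tendsto_cong)
  have ng: "(\<lambda>n. real n * g (Suc n)) \<longlonglongrightarrow> L"
  proof -
    have "(\<lambda>n. L * (real n / (real n + 1)) - (s (Suc n) / real (Suc n)) * (real n / (real n + 1))) \<longlonglongrightarrow> L * 1 - 0 * 1"
      by (intro tendsto_intros LIMSEQ_Suc[OF s0]) real_asymp+
    then show ?thesis by (simp add: g_def field_simps power2_eq_square)
  qed
  have g0: "g \<longlonglongrightarrow> 0"
  proof -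
    have "(\<lambda>n. L / real n - s n / real n * (1 / real n)) \<longlonglongrightarrow> 0 - 0 * 0"
      by (intro tendsto_diff tendsto_mult s0) real_asymp+
    then show ?thesis by (simp add: g_def[abs_def] power2_eq_square)
  qed
  have tele: "(\<lambda>k. g (N + 1 + k) - g (N + 1 + Suc k)) sums g (N + 1)" for N
    using telescope_sums'[OF LIMSEQ_ignore_initial_segment[OF g0, of "N + 1"]]
    by (simp add: add_ac)
  have csum: "(\<lambda>k. c (N + 1 + k) / (real (N + 1 + k))\<^sup>2) sums
      (\<Sum>k. c (N + 1 + k) / (real (N + 1 + k))\<^sup>2)" for N
    using summable_ignore_initial_segment[OF null_tail(1)[OF c], of "N + 1"]
    by (simp add: summable_sums add_ac)
  have fs: "(\<lambda>k. f (N + 1 + k)) sums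
     (g (N + 1) + (\<Sum>k. c (N + 1 + k) / (real (N + 1 + k))\<^sup>2))" for N
    using sums_add[OF tele[of N] csum[of N]] by (simp add: c_def)
  then show "summable (\<lambda>k. f (N + 1 + k))" by (rule sums_summable)
  have "(\<lambda>N. real N * g (Suc N) + real N * (\<Sum>k. c (N + 1 + k) / (real (N + 1 + k))\<^sup>2)) \<longlonglongrightarrow> L + 0"
    by (intro tendsto_add ng null_tail(2)[OF c])
  then show "(\<lambda>N. real N * (\<Sum>k. f (N + 1 + k))) \<longlonglongrightarrow> L"
    using fs by (simp add: sums_iff distrib_left)
qed

text \<open>
  Multiplication by \<open>2 sin (\<alpha> / 2)\<close> makes the sum telescope.
\<close>

lemma bounded_cos_sums:
  fixes \<alpha> \<beta> :: real
  assumes "sin (\<alpha> / 2) \<noteq> 0"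
  shows "\<bar>\<Sum>k<n. cos (real k * \<alpha> + \<beta>)\<bar> \<le> 1 / \<bar>sin (\<alpha> / 2)\<bar>"
proof -
  have "2 * sin (\<alpha> / 2) * cos (real k * \<alpha> + \<beta>)
      = sin (real (Suc k) * \<alpha> + \<beta> - \<alpha> / 2) - sin (real k * \<alpha> + \<beta> - \<alpha> / 2)" for k
  proof -
    have "real (Suc k) * \<alpha> + \<beta> - \<alpha> / 2 = (real k * \<alpha> + \<beta>) + \<alpha> / 2" by (simp add: algebra_simps)
    then show ?thesis by (simp only: sin_add sin_diff) simp
  qed
  then have eq: "2 * sin (\<alpha> / 2) * (\<Sum>k<n. cos (real k * \<alpha> + \<beta>))
      = sin (real n * \<alpha> + \<beta> - \<alpha> / 2) - sin (\<beta> - \<alpha> / 2)"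
    using sum_lessThan_telescope[of "\<lambda>k. sin (real k * \<alpha> + \<beta> - \<alpha> / 2)" n]
    by (simp add: sum_distrib_left del: of_nat_Suc)
  have "2 * (\<bar>sin (\<alpha> / 2)\<bar> * \<bar>\<Sum>k<n. cos (real k * \<alpha> + \<beta>)\<bar>)
      = \<bar>sin (real n * \<alpha> + \<beta> - \<alpha> / 2) - sin (\<beta> - \<alpha> / 2)\<bar>"
    unfolding eq[symmetric] abs_mult by simp
  also have "\<dots> \<le> 2"
    using abs_sin_le_one[of "real n * \<alpha> + \<beta> - \<alpha> / 2"] abs_sin_le_one[of "\<beta> - \<alpha> / 2"] by linarith
  finally show ?thesis using assms by (simp add: field_simps)
qed

text \<open>
  The product of cosines is half the sum of the cosines with frequencies \<open>\<theta> - \<phi>\<close> and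
  \<open>\<theta> + \<phi>\<close>. Since \<open>0 < (\<theta> + \<phi>) / 2 < \<pi>\<close>, the second always averages out, and so does the first
  unless \<open>\<theta> = \<phi>\<close>; in that case the phases agree too, and it is the constant \<open>1\<close>.
\<close>

lemma tail_of_cos_product:
  fixes \<theta> \<phi> A b c :: real and f :: "nat \<Rightarrow> real"
  assumes \<theta>: "0 < \<theta>" "\<theta> < pi" and \<phi>: "0 < \<phi>" "\<phi> < pi"
    and phase: "\<theta> = \<phi> \<Longrightarrow> b = c"
    and close: "(\<lambda>n. (real n)\<^sup>2 * f n - A * (cos (real n * \<theta> + b) * cos (real n * \<phi> + c))) \<longlonglongrightarrow> 0"
  shows "summable (\<lambda>k. f (N + 1 + k))"
    and "(\<lambda>N. real N * (\<Sum>k. f (N + 1 + k))) \<longlonglongrightarrow> (if \<theta> = \<phi> then A / 2 else 0)"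
proof -
  define L where "L = (if \<theta> = \<phi> then A / 2 else 0)"
  define a where "a n = A * (cos (real n * \<theta> + b) * cos (real n * \<phi> + c)) - L" for n
  have prod: "A * (cos (real n * \<theta> + b) * cos (real n * \<phi> + c))
     = A / 2 * cos (real n * (\<theta> - \<phi>) + (b - c)) + A / 2 * cos (real n * (\<theta> + \<phi>) + (b + c))" for n
  proof -
    have "real n * (\<theta> - \<phi>) + (b - c) = (real n * \<theta> + b) - (real n * \<phi> + c)"
      "real n * (\<theta> + \<phi>) + (b + c) = (real n * \<theta> + b) + (real n * \<phi> + c)"
      by (simp_all add: algebra_simps)
    then show ?thesis by (simp only: cos_times_cos) (simp add: algebra_simps)
  qed
  have plus: "sin ((\<theta> + \<phi>) / 2) \<noteq> 0"
    using sin_gt_zero[of "(\<theta> + \<phi>) / 2"] \<theta> \<phi> by simp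
  have "\<exists>C. \<forall>n. \<bar>\<Sum>k<n. a k\<bar> \<le> C"
  proof (cases "\<theta> = \<phi>")
    case True
    have "a n = A / 2 * cos (real n * (\<theta> + \<phi>) + (b + c))" for n
      using True phase unfolding a_def prod L_def by simp
    then have "\<bar>\<Sum>k<n. a k\<bar> \<le> \<bar>A / 2\<bar> * (1 / \<bar>sin ((\<theta> + \<phi>) / 2)\<bar>)" for n
      unfolding sum_distrib_left[symmetric] abs_mult
      by (simp only: sum_distrib_left[symmetric] abs_mult) (intro mult_left_mono bounded_cos_sums plus abs_ge_zero)
    then show ?thesis by blast
  next
    case False
    have minus: "sin ((\<theta> - \<phi>) / 2) \<noteq> 0"
    proof
      assume "sin ((\<theta> - \<phi>) / 2) = 0"
      moreover have "\<bar>(\<theta> - \<phi>) / 2\<bar> < pi" using \<theta> \<phi> by auto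
      ultimately have "(\<theta> - \<phi>) / 2 = 0" by (metis sin_eq_0_pi abs_less_iff minus_less_iff)
      then show False using False by simp
    qed
    have "\<bar>\<Sum>k<n. a k\<bar> \<le> \<bar>A / 2\<bar> * (1 / \<bar>sin ((\<theta> - \<phi>) / 2)\<bar>) + \<bar>A / 2\<bar> * (1 / \<bar>sin ((\<theta> + \<phi>) / 2)\<bar>)" for n
    proof -
      define X where "X = (\<Sum>k<n. cos (real k * (\<theta> - \<phi>) + (b - c)))"
      define Y where "Y = (\<Sum>k<n. cos (real k * (\<theta> + \<phi>) + (b + c)))"
      have "(\<Sum>k<n. a k) = A / 2 * X + A / 2 * Y"
        unfolding a_def prod L_def X_def Y_def using False by (simp add: sum.distrib sum_distrib_left)
      moreover have "\<bar>A / 2 * X\<bar> \<le> \<bar>A / 2\<bar> * (1 / \<bar>sin ((\<theta> - \<phi>) / 2)\<bar>)"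
        unfolding abs_mult X_def by (rule mult_left_mono[OF bounded_cos_sums[OF minus]]) simp
      moreover have "\<bar>A / 2 * Y\<bar> \<le> \<bar>A / 2\<bar> * (1 / \<bar>sin ((\<theta> + \<phi>) / 2)\<bar>)"
        unfolding abs_mult Y_def by (rule mult_left_mono[OF bounded_cos_sums[OF plus]]) simp
      ultimately show ?thesis by linarith
    qed
    then show ?thesis by blast
  qed
  then obtain C where C: "\<And>n. \<bar>\<Sum>k<n. a k\<bar> \<le> C" by blast
  have "(\<lambda>n. (real n)\<^sup>2 * f n - (L + a n)) \<longlonglongrightarrow> 0"
    using close by (simp add: a_def)
  note * = tail_of_bounded_oscillation[OF C this]
  show "summable (\<lambda>k. f (N + 1 + k))" by (rule *(1))
  show "(\<lambda>N. real N * (\<Sum>k. f (N + 1 + k))) \<longlonglongrightarrow> (if \<theta> = \<phi> then A / 2 else 0)"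
    using *(2) by (simp add: L_def)
qed

section \<open>The three tail limits\<close>

text \<open>
  Asymptotic equality of bounded sequences, in the sense of null differences, is compatible with products.
\<close>

lemma null_difference_mult:
  fixes a b a' b' :: "nat \<Rightarrow> real"
  assumes "(\<lambda>n. a n - a' n) \<longlonglongrightarrow> 0" "(\<lambda>n. b n - b' n) \<longlonglongrightarrow> 0"
    and a': "\<And>n. \<bar>a' n\<bar> \<le> C" and b': "\<And>n. \<bar>b' n\<bar> \<le> D"
  shows "(\<lambda>n. a n * b n - a' n * b' n) \<longlonglongrightarrow> 0"
proof -
  have "(\<lambda>n. (a n - a' n) * (b n - b' n) + (a n - a' n) * b' n + (b n - b' n) * a' n) \<longlonglongrightarrow> 0 * 0 + 0 + 0"
    by (intro tendsto_add tendsto_mult assms(1,2)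
        lim_null_mult_right_bounded[OF assms(1), where B = D] lim_null_mult_right_bounded[OF assms(2), where B = C])
      (use a' b' in auto)
  then show ?thesis by (simp add: algebra_simps)
qed

lemma legendre_tail:
  assumes \<theta>: "0 < \<theta>" "\<theta> < pi" and \<phi>: "0 < \<phi>" "\<phi> < pi"
  defines "f \<equiv> \<lambda>n. (2 * real n + 1) * poly (legendre_poly n) (cos \<theta>) * poly (legendre_poly n) (cos \<phi>)
            / (2 * real n * (real n + 1))"
  shows "summable (\<lambda>k. f (N + 1 + k))"
    and "(\<lambda>N. real N * (\<Sum>k. f (N + 1 + k))) \<longlonglongrightarrow> (if \<theta> = \<phi> then 1 / (pi * sin \<theta>) else 0)"
proof -
  define \<kappa> where "\<kappa> = sqrt (2 / pi)"
  define w where "w = sqrt (sin \<theta>) * sqrt (sin \<phi>)"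
  define a where "a \<tau> n = sqrt (real n) * (sqrt (sin \<tau>) * poly (legendre_poly n) (cos \<tau>))" for \<tau> n
  define a' where "a' \<tau> n = \<kappa> * cos (real n * \<tau> + (\<tau> / 2 - pi / 4))" for \<tau> n
  have phase: "\<theta> / 2 - pi / 4 = \<phi> / 2 - pi / 4" if "\<theta> = \<phi>" using that by simp
  have s: "sin \<theta> > 0" "sin \<phi> > 0" using \<theta> \<phi> by (auto intro: sin_gt_zero)
  then have w: "w > 0" by (simp add: w_def)
  have \<kappa>: "\<kappa> \<ge> 0" "\<kappa> * \<kappa> = 2 / pi" by (simp_all add: \<kappa>_def)
  have bound: "\<bar>a' \<tau> n\<bar> \<le> \<kappa>" for \<tau> n
    using mult_left_mono[OF abs_cos_le_one \<kappa>(1)] \<kappa>(1) by (simp add: a'_def abs_mult)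
  have close: "(\<lambda>n. a \<theta> n * a \<phi> n - a' \<theta> n * a' \<phi> n) \<longlonglongrightarrow> 0"
    using legendre_asymptotics[OF \<theta>] legendre_asymptotics[OF \<phi>] bound
    by (intro null_difference_mult[where C = \<kappa> and D = \<kappa>]) (simp_all add: a_def a'_def \<kappa>_def)
  have f: "(real n)\<^sup>2 * f n = (real n + 1 / 2) / (real n + 1) * (a \<theta> n * a \<phi> n) / w" for n
  proof -
    have "a \<theta> n * a \<phi> n = w * (real n * (poly (legendre_poly n) (cos \<theta>) * poly (legendre_poly n) (cos \<phi>)))"
    proof -
      have "a \<theta> n * a \<phi> n = (sqrt (real n) * sqrt (real n)) * (w * (poly (legendre_poly n) (cos \<theta>) * poly (legendre_poly n) (cos \<phi>)))"
        by (simp only: a_def w_def mult_ac)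
      then show ?thesis by simp
    qed
    moreover have "m\<^sup>2 * ((2 * m + 1) * p * q / (2 * m * (m + 1))) = (m + 1 / 2) / (m + 1) * (m * (p * q))"
      if "m \<ge> 0" for m p q :: real
      using that by (cases "m = 0") (simp_all add: divide_simps, simp_all add: algebra_simps power2_eq_square)
    ultimately show ?thesis
      using w by (simp add: f_def)
  qed
  have "(\<lambda>n. (real n + 1 / 2) / (real n + 1) * (a \<theta> n * a \<phi> n - a' \<theta> n * a' \<phi> n) / w
      + ((real n + 1 / 2) / (real n + 1) - 1) * (a' \<theta> n * a' \<phi> n) / w) \<longlonglongrightarrow> 1 * 0 / w + 0 / w"
  proof (intro tendsto_add tendsto_divide tendsto_mult close tendsto_const)
    show "(\<lambda>n. ((real n + 1 / 2) / (real n + 1) - 1) * (a' \<theta> n * a' \<phi> n)) \<longlonglongrightarrow> 0"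
    proof (rule lim_null_mult_right_bounded[where B = "\<kappa> * \<kappa>"])
      show "eventually (\<lambda>n. norm (a' \<theta> n * a' \<phi> n) \<le> \<kappa> * \<kappa>) sequentially"
        using bound \<kappa>(1) by (auto simp: abs_mult intro!: always_eventually mult_mono)
    qed real_asymp
  qed (use w in simp_all, real_asymp)
  moreover have "(real n + 1 / 2) / (real n + 1) * (a \<theta> n * a \<phi> n - a' \<theta> n * a' \<phi> n) / w
      + ((real n + 1 / 2) / (real n + 1) - 1) * (a' \<theta> n * a' \<phi> n) / w
    = (real n)\<^sup>2 * f n - 2 / pi / w * (cos (real n * \<theta> + (\<theta> / 2 - pi / 4)) * cos (real n * \<phi> + (\<phi> / 2 - pi / 4)))" for n
  proof -
    have "2 / pi / w * (cos (real n * \<theta> + (\<theta> / 2 - pi / 4)) * cos (real n * \<phi> + (\<phi> / 2 - pi / 4)))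
        = a' \<theta> n * a' \<phi> n / w"
      unfolding \<kappa>(2)[symmetric] by (simp add: a'_def)
    then show ?thesis
      unfolding f by (simp add: diff_divide_distrib algebra_simps)
  qed
  ultimately have "(\<lambda>n. (real n)\<^sup>2 * f n
      - 2 / pi / w * (cos (real n * \<theta> + (\<theta> / 2 - pi / 4)) * cos (real n * \<phi> + (\<phi> / 2 - pi / 4)))) \<longlonglongrightarrow> 0"
    by (simp only: mult_zero_right div_0 add_0)
  note * = tail_of_cos_product[OF \<theta> \<phi> phase this]
  show "summable (\<lambda>k. f (N + 1 + k))" by (rule *(1))
  have "(if \<theta> = \<phi> then 2 / pi / w / 2 else 0) = (if \<theta> = \<phi> then 1 / (pi * sin \<theta>) else 0)"
    using s by (simp add: w_def)
  then show "(\<lambda>N. real N * (\<Sum>k. f (N + 1 + k))) \<longlonglongrightarrow> (if \<theta> = \<phi> then 1 / (pi * sin \<theta>) else 0)"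
    using *(2) by (simp only:)
qed

lemma chebyshev_T_tail:
  assumes \<theta>: "0 < \<theta>" "\<theta> < pi" and \<phi>: "0 < \<phi>" "\<phi> < pi"
  defines "f \<equiv> \<lambda>n. poly (chebyshev_T n) (cos \<theta>) * poly (chebyshev_T n) (cos \<phi>) / (real n)\<^sup>2"
  shows "summable (\<lambda>k. f (N + 1 + k))"
    and "(\<lambda>N. real N * (\<Sum>k. f (N + 1 + k))) \<longlonglongrightarrow> (if \<theta> = \<phi> then 1 / 2 else 0)"
proof -
  have "eventually (\<lambda>n. (real n)\<^sup>2 * f n - 1 * (cos (real n * \<theta> + 0) * cos (real n * \<phi> + 0)) = 0) sequentially"
    using eventually_gt_at_top[of 0] by eventually_elim (simp add: f_def chebyshev_T_cos)
  then have "(\<lambda>n. (real n)\<^sup>2 * f n - 1 * (cos (real n * \<theta> + 0) * cos (real n * \<phi> + 0))) \<longlonglongrightarrow> 0"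
    by (rule tendsto_eventually)
  note * = tail_of_cos_product[OF \<theta> \<phi> refl this]
  show "summable (\<lambda>k. f (N + 1 + k))" by (rule *(1))
  show "(\<lambda>N. real N * (\<Sum>k. f (N + 1 + k))) \<longlonglongrightarrow> (if \<theta> = \<phi> then 1 / 2 else 0)"
    by (rule *(2))
qed

text \<open>
  The shift \<open>\<theta> - \<pi> / 2\<close> turns \<open>sin ((n + 1) \<theta>)\<close> into a cosine of the form used for all three
  families.
\<close>

lemma chebyshev_U_tail:
  assumes \<theta>: "0 < \<theta>" "\<theta> < pi" and \<phi>: "0 < \<phi>" "\<phi> < pi"
  defines "f \<equiv> \<lambda>n. poly (chebyshev_U n) (cos \<theta>) * poly (chebyshev_U n) (cos \<phi>) / (real n * (real n + 2))"
  shows "summable (\<lambda>k. f (N + 1 + k))"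
    and "(\<lambda>N. real N * (\<Sum>k. f (N + 1 + k))) \<longlonglongrightarrow> (if \<theta> = \<phi> then 1 / (2 * (sin \<theta>)\<^sup>2) else 0)"
proof -
  define A where "A = 1 / (sin \<theta> * sin \<phi>)"
  define b where "b n = A * (cos (real n * \<theta> + (\<theta> - pi / 2)) * cos (real n * \<phi> + (\<phi> - pi / 2)))" for n
  have phase: "\<theta> - pi / 2 = \<phi> - pi / 2" if "\<theta> = \<phi>" using that by simp
  have s: "sin \<theta> > 0" "sin \<phi> > 0" using \<theta> \<phi> by (auto intro: sin_gt_zero)
  then have A: "A > 0" by (simp add: A_def)
  have U: "poly (chebyshev_U n) (cos \<tau>) = cos (real n * \<tau> + (\<tau> - pi / 2)) / sin \<tau>" if "sin \<tau> > 0" for n \<tau>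
  proof -
    have "real n * \<tau> + (\<tau> - pi / 2) = (real n + 1) * \<tau> - pi / 2" by (simp add: algebra_simps)
    then have "cos (real n * \<tau> + (\<tau> - pi / 2)) = sin ((real n + 1) * \<tau>)" by (simp only: cos_diff) simp
    then show ?thesis using that by (simp add: chebyshev_U_cos[symmetric])
  qed
  have f: "(real n)\<^sup>2 * f n = real n / (real n + 2) * b n" for n
    using s by (cases "n = 0") (simp_all add: f_def U b_def A_def power2_eq_square)
  have "(\<lambda>n. (real n / (real n + 2) - 1) * b n) \<longlonglongrightarrow> 0"
  proof (rule lim_null_mult_right_bounded[where B = A])
    have "\<bar>cos p * cos q\<bar> \<le> 1" for p q :: real
      unfolding abs_mult by (intro mult_le_one abs_cos_le_one abs_ge_zero)
    then show "eventually (\<lambda>n. norm (b n) \<le> A) sequentially"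
      using A mult_left_mono[of _ 1 A] by (intro always_eventually allI) (simp add: b_def abs_mult)
  qed real_asymp
  then have "(\<lambda>n. (real n)\<^sup>2 * f n - A * (cos (real n * \<theta> + (\<theta> - pi / 2)) * cos (real n * \<phi> + (\<phi> - pi / 2)))) \<longlonglongrightarrow> 0"
    unfolding f b_def[symmetric] by (simp add: left_diff_distrib)
  note * = tail_of_cos_product[OF \<theta> \<phi> phase this]
  show "summable (\<lambda>k. f (N + 1 + k))" by (rule *(1))
  have "(if \<theta> = \<phi> then A / 2 else 0) = (if \<theta> = \<phi> then 1 / (2 * (sin \<theta>)\<^sup>2) else 0)"
    by (simp add: A_def power2_eq_square)
  then show "(\<lambda>N. real N * (\<Sum>k. f (N + 1 + k))) \<longlonglongrightarrow> (if \<theta> = \<phi> then 1 / (2 * (sin \<theta>)\<^sup>2) else 0)"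
    using *(2) by (simp only:)
qed

theorem corollary1p6:
  fixes x y :: real
  assumes "x \<in> {-1<..<1}" and "y \<in> {-1<..<1}"
  shows
    "((\<forall>N. summable (\<lambda>k. let n = N + 1 + k in
          (2 * real n + 1) * poly (legendre_poly n) x * poly (legendre_poly n) y
            / (2 * real n * (real n + 1)))) \<and>
      (\<lambda>N. real N * (\<Sum>k. let n = N + 1 + k in
          (2 * real n + 1) * poly (legendre_poly n) x * poly (legendre_poly n) y
            / (2 * real n * (real n + 1))))
        \<longlonglongrightarrow> (if x = y then 1 / (pi * sqrt (1 - x\<^sup>2)) else 0)) \<and>
     ((\<forall>N. summable (\<lambda>k. let n = N + 1 + k in
          poly (chebyshev_T n) x * poly (chebyshev_T n) y / (real n)\<^sup>2)) \<and>
      (\<lambda>N. real N * (\<Sum>k. let n = N + 1 + k in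
          poly (chebyshev_T n) x * poly (chebyshev_T n) y / (real n)\<^sup>2))
        \<longlonglongrightarrow> (if x = y then 1 / 2 else 0)) \<and>
     ((\<forall>N. summable (\<lambda>k. let n = N + 1 + k in
          poly (chebyshev_U n) x * poly (chebyshev_U n) y / (real n * (real n + 2)))) \<and>
      (\<lambda>N. real N * (\<Sum>k. let n = N + 1 + k in
          poly (chebyshev_U n) x * poly (chebyshev_U n) y / (real n * (real n + 2))))
        \<longlonglongrightarrow> (if x = y then 1 / (2 * (1 - x\<^sup>2)) else 0))"
proof -
  define \<theta> \<phi> where "\<theta> = arccos x" and "\<phi> = arccos y"
  have \<theta>: "0 < \<theta>" "\<theta> < pi" and \<phi>: "0 < \<phi>" "\<phi> < pi"
    using assms arccos_lt_bounded[of x] arccos_lt_bounded[of y] by (auto simp: \<theta>_def \<phi>_def)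
  have cos: "x = cos \<theta>" "y = cos \<phi>" using assms by (simp_all add: \<theta>_def \<phi>_def)
  have eq: "x = y \<longleftrightarrow> \<theta> = \<phi>" unfolding \<theta>_def \<phi>_def using cos \<theta>_def \<phi>_def by auto
  have sq: "1 - x\<^sup>2 = (sin \<theta>)\<^sup>2" by (simp add: cos sin_squared_eq)
  have "sqrt (1 - x\<^sup>2) = sin \<theta>" unfolding sq using sin_gt_zero[OF \<theta>] by simp
  then show ?thesis
    using legendre_tail[OF \<theta> \<phi>] chebyshev_T_tail[OF \<theta> \<phi>] chebyshev_U_tail[OF \<theta> \<phi>]
    unfolding Let_def eq sq by (simp only: cos) blast
qed

end
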